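(* Let $D\subsetneq\mathbb{R}^n$ be an open set with $\partial D\neq\emptyset$. For any $x\in D$ and $r\in(0,1)$, $$B_c(x,R_1)\subset B_{\tilde c}(x,r)\subset B_c(x,R_2),$$ where $R_1=\frac{r}{(1+r)d(x)}$ and $R_2=\frac{r}{(1-r)d(x)}$. Moreover, $R_2/R_1\to 1$ as $r\to 0$.
   Context: $d(x)=d(x,\partial D)$ is the Euclidean distance from $x$ to the boundary $\partial D$ of $D$ in $\mathbb{R}^n$. For $x,y\in D$: $\tilde c_D(x,y)=\sup_{p\in\partial D}\frac{|x-y|}{\max\{|x-p|,|y-p|\}}$, and the Cassinian metric is $c_D(x,y)=\sup_{p\in\partial D}\frac{|x-y|}{|x-p||y-p|}$. Metric balls: $B_{\tilde c}(x,r)=\{y\in D:\tilde c_D(x,y)<r\}$ and $B_c(x,R)=\{y\in D: c_D(x,y)<R\}$. *)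

theory Defs
  imports "HOL-Analysis.Analysis"
begin

text \<open>
  The suprema below are taken in \<^typ>\<open>real\<close>. For open \<open>D\<close> with nonempty frontier and
  \<open>x, y \<in> D\<close> they range over nonempty bounded sets, and all denominators are positive.
\<close>

definition bdist :: "'a::euclidean_space set \<Rightarrow> 'a \<Rightarrow> real" where
  "bdist D x = infdist x (frontier D)"

definition cassinian_tilde :: "'a::euclidean_space set \<Rightarrow> 'a \<Rightarrow> 'a \<Rightarrow> real" where
  "cassinian_tilde D x y = (SUP p\<in>frontier D. dist x y / max (dist x p) (dist y p))"

definition cassinian :: "'a::euclidean_space set \<Rightarrow> 'a \<Rightarrow> 'a \<Rightarrow> real" where
  "cassinian D x y = (SUP p\<in>frontier D. dist x y / (dist x p * dist y p))"

definition ball_tilde :: "'a::euclidean_space set \<Rightarrow> 'a \<Rightarrow> real \<Rightarrow> 'a set" where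
  "ball_tilde D x r = {y \<in> D. cassinian_tilde D x y < r}"

definition ball_cassinian :: "'a::euclidean_space set \<Rightarrow> 'a \<Rightarrow> real \<Rightarrow> 'a set" where
  "ball_cassinian D x R = {y \<in> D. cassinian D x y < R}"

definition R1 :: "'a::euclidean_space set \<Rightarrow> 'a \<Rightarrow> real \<Rightarrow> real" where
  "R1 D x r = r / ((1 + r) * bdist D x)"

definition R2 :: "'a::euclidean_space set \<Rightarrow> 'a \<Rightarrow> real \<Rightarrow> real" where
  "R2 D x r = r / ((1 - r) * bdist D x)"

end

theory Submission
  imports Defs
begin

text \<open>
  Write \<open>s = |x - y|\<close>, \<open>d = d(x)\<close>. If \<open>c(x,y) = R\<close>, a nearest boundary point gives
  \<open>s \<le> R d (d + s)\<close>, so \<open>s/d \<le> R d / (1 - R d)\<close>, and \<open>s/d\<close> dominates the tilde metric.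
  Conversely, if the tilde metric is \<open>t < 1\<close>, then \<open>|y - p| \<ge> (1 - t) |x - p|\<close> for all boundary
  points \<open>p\<close>, hence \<open>min (|x - p|) (|y - p|) \<ge> (1 - t) d\<close> and \<open>c(x,y) \<le> t / ((1 - t) d)\<close>.
\<close>

lemma bdist_le:
  assumes "p \<in> frontier D"
  shows "bdist D x \<le> dist x p"
  unfolding bdist_def using assms by (rule infdist_le)

text \<open>An open set is disjoint from its frontier, and a point outside a nonempty closed set has
  positive distance to it.\<close>

lemma bdist_pos:
  assumes "open D" "frontier D \<noteq> {}" "x \<in> D"
  shows "0 < bdist D x"
proof -
  have "x \<notin> frontier D"
    using assms by (simp add: frontier_def interior_open)
  then show ?thesis
    unfolding bdist_def using assms(2) infdist_pos_not_in_closed[of "frontier D" x]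
    by simp
qed

lemma bdist_attained:
  assumes "frontier D \<noteq> {}"
  obtains p where "p \<in> frontier D" "dist x p = bdist D x"
proof -
  obtain p where "p \<in> frontier D" "infdist x (frontier D) = dist x p"
    using infdist_attains_inf[OF frontier_closed assms] by blast
  then show ?thesis
    using that by (simp add: bdist_def)
qed

context
  fixes D :: "'a::euclidean_space set" and x y :: 'a
  assumes D: "open D" "frontier D \<noteq> {}" and x: "x \<in> D" and y: "y \<in> D"
begin

text \<open>The bound is independent of \<open>p\<close>, so it serves twice: it shows that the
  family is bounded above, and it passes to the supremum.\<close>

lemma cassinian_tilde_term_le:
  assumes "p \<in> frontier D"
  shows "dist x y / max (dist x p) (dist y p) \<le> dist x y / bdist D x"
proof -
  have "0 < bdist D x" and "bdist D x \<le> max (dist x p) (dist y p)"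
    using bdist_pos[OF D x] bdist_le[OF assms, of x] by (simp_all add: le_max_iff_disj)
  then show ?thesis
    by (intro frac_le) simp_all
qed

lemma cassinian_tilde_ge:
  assumes "p \<in> frontier D"
  shows "dist x y / max (dist x p) (dist y p) \<le> cassinian_tilde D x y"
  unfolding cassinian_tilde_def using assms
  by (intro cSUP_upper bdd_aboveI2[where M = "dist x y / bdist D x"] cassinian_tilde_term_le)

lemma cassinian_tilde_le: "cassinian_tilde D x y \<le> dist x y / bdist D x"
  unfolding cassinian_tilde_def using D(2) by (intro cSUP_least cassinian_tilde_term_le)

lemma cassinian_ge:
  assumes "p \<in> frontier D"
  shows "dist x y / (dist x p * dist y p) \<le> cassinian D x y"
  unfolding cassinian_def using assms
proof (intro cSUP_upper bdd_aboveI2)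
  fix q assume q: "q \<in> frontier D"
  \<comment> \<open>Any bound uniform in \<open>q\<close> would do; it only certifies that the real
    supremum is a genuine one.\<close>
  show "dist x y / (dist x q * dist y q) \<le> dist x y / (bdist D x * bdist D y)"
    using bdist_pos[OF D x] bdist_pos[OF D y] bdist_le[OF q, of x] bdist_le[OF q, of y]
    by (intro divide_left_mono mult_mono) (auto intro!: mult_pos_pos)
qed

lemma cassinian_tilde_less:
  assumes r: "0 < r" and c: "cassinian D x y < r / ((1 + r) * bdist D x)"
  shows "cassinian_tilde D x y < r"
proof -
  let ?s = "dist x y" and ?d = "bdist D x"
  have d: "0 < ?d" using bdist_pos[OF D x] .
  obtain p where p: "p \<in> frontier D" "dist x p = ?d"
    using bdist_attained[OF D(2)] .
  have b: "0 < dist y p"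
    using bdist_pos[OF D y] bdist_le[OF p(1), of y] by linarith
  have "?s / (?d * dist y p) < r / ((1 + r) * ?d)"
    using cassinian_ge[OF p(1)] c p(2) by simp
  then have "?s / dist y p / ?d < r / (1 + r) / ?d"
    by (simp add: mult.commute)
  then have "?s / dist y p < r / (1 + r)"
    using d unfolding divide_less_cancel by simp
  then have "?s * (1 + r) < r * dist y p"
    using b r by (simp add: field_simps)
  \<comment> \<open>Now \<open>r * ?s\<close> occurs on both sides and cancels; this is what the
    factor \<open>1 + r\<close> in the radius is for.\<close>
  also have "\<dots> \<le> r * (?d + ?s)"
    using dist_triangle[of y p x] p(2) r by (simp add: dist_commute)
  finally have "?s / ?d < r"
    using d by (simp add: field_simps)
  then show ?thesis
    using cassinian_tilde_le by linarith
qed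

lemma cassinian_less:
  assumes r: "r < 1" and c: "cassinian_tilde D x y < r"
  shows "cassinian D x y < r / ((1 - r) * bdist D x)"
proof -
  \<comment> \<open>The termwise bound uses \<open>t\<close> rather than \<open>r\<close> because a
    supremum preserves only weak inequalities; strictness returns at the end, as
    \<open>u / (1 - u)\<close> increases strictly for \<open>u < 1\<close>.\<close>
  define t where "t = cassinian_tilde D x y"
  let ?s = "dist x y" and ?d = "bdist D x"
  have d: "0 < ?d" using bdist_pos[OF D x] .
  have t: "t < r" using c t_def by simp
  have "?s / (dist x p * dist y p) \<le> t / ((1 - t) * ?d)" if p: "p \<in> frontier D" for p
  proof -
    let ?a = "dist x p" and ?b = "dist y p"
    have a: "?d \<le> ?a" using bdist_le[OF p] .
    have b: "0 < ?b"
      using bdist_pos[OF D y] bdist_le[OF p, of y] by linarith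
    have max_pos: "0 < max ?a ?b" using b by (simp add: less_max_iff_disj)
    have st: "?s / max ?a ?b \<le> t"
      using cassinian_tilde_ge[OF p] t_def by simp
    have "0 \<le> ?s / max ?a ?b" using max_pos by (intro divide_nonneg_pos) auto
    then have t0: "0 \<le> t" using st by linarith
    \<comment> \<open>If \<open>?a\<close> is the larger distance, \<open>st\<close> reads
      \<open>?s \<le> t * ?a\<close>, and the triangle inequality keeps \<open>y\<close> away from
      \<open>p\<close>.\<close>
    have min_ge: "(1 - t) * ?d \<le> min ?a ?b"
    proof (cases "?a \<le> ?b")
      case True
      have "(1 - t) * ?d \<le> ?d" using t0 d by (simp add: algebra_simps)
      then show ?thesis using True a by simp
    next
      case False
      then have "?s \<le> t * ?a"
        using st max_pos by (simp add: pos_divide_le_eq max_def)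
      then have "(1 - t) * ?a \<le> ?b"
        using dist_triangle[of x p y] by (simp add: algebra_simps)
      moreover have "(1 - t) * ?d \<le> (1 - t) * ?a"
        using a t r by (intro mult_left_mono) auto
      ultimately show ?thesis using False by simp
    qed
    \<comment> \<open>This splits off the term bounded by \<open>st\<close>, leaving a division by
      the minimum.\<close>
    have "?a * ?b = max ?a ?b * min ?a ?b" by (simp add: max_def min_def)
    then have "?s / (?a * ?b) = ?s / max ?a ?b / min ?a ?b"
      by (simp only: divide_divide_eq_left)
    also have "\<dots> \<le> t / ((1 - t) * ?d)"
      using st t0 min_ge t r d by (intro frac_le) auto
    finally show ?thesis .
  qed
  then have "cassinian D x y \<le> t / ((1 - t) * ?d)"
    unfolding cassinian_def using D(2) by (intro cSUP_least)
  also have "t / ((1 - t) * ?d) < r / ((1 - r) * ?d)"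
  proof -
    have "t / (1 - t) < r / (1 - r)"
      using t r by (simp add: divide_less_eq less_divide_eq) (simp add: algebra_simps)
    then have "t / (1 - t) / ?d < r / (1 - r) / ?d"
      using d by (rule divide_strict_right_mono)
    then show ?thesis
      by (simp only: divide_divide_eq_left)
  qed
  finally show ?thesis .
qed

end

theorem theorem3:
  fixes D :: "(real ^ 'n) set"
  assumes "open D" and "D \<noteq> UNIV" and "frontier D \<noteq> {}"
  shows "\<forall>x\<in>D.
    (\<forall>r\<in>{0<..<1}. ball_cassinian D x (R1 D x r) \<subseteq> ball_tilde D x r
                 \<and> ball_tilde D x r \<subseteq> ball_cassinian D x (R2 D x r))
    \<and> ((\<lambda>r. R2 D x r / R1 D x r) \<longlongrightarrow> 1) (at_right 0)"
proof (intro ballI conjI)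
  fix x r assume "x \<in> D" and "r \<in> {0<..<1::real}"
  then show "ball_cassinian D x (R1 D x r) \<subseteq> ball_tilde D x r"
    and "ball_tilde D x r \<subseteq> ball_cassinian D x (R2 D x r)"
    using cassinian_tilde_less[OF assms(1,3)] cassinian_less[OF assms(1,3)]
    by (auto simp: ball_cassinian_def ball_tilde_def R1_def R2_def)
next
  fix x assume "x \<in> D"
  then have d: "bdist D x \<noteq> 0"
    using bdist_pos[OF assms(1,3)] by force
  have "((\<lambda>r::real. (1 + r) / (1 - r)) \<longlongrightarrow> (1 + 0) / (1 - 0)) (at_right 0)"
    by (intro tendsto_intros) auto
  \<comment> \<open>Restricting to \<open>r > 0\<close> allows cancelling \<open>r\<close>; at
    \<open>r = 0\<close> the quotient of radii is \<open>0 / 0 = 0\<close>.\<close>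
  moreover have "\<forall>\<^sub>F r in at_right 0. (1 + r) / (1 - r) = R2 D x r / R1 D x r"
    using eventually_at_right_less[of 0]
    by eventually_elim (use d in \<open>simp add: R1_def R2_def\<close>)
  ultimately show "((\<lambda>r. R2 D x r / R1 D x r) \<longlongrightarrow> 1) (at_right 0)"
    by (simp add: tendsto_cong)
qed

end
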